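(* Let $N\geq 1$ and $M\geq 0$ be integers, and let $\kappa\in(0,1)\cap\mathbb{Q}$ be such that $\Gamma(\kappa)$ is transcendental. Define $$\widetilde{\beta}(N,M)=\begin{cases} \dfrac{M}{2N}, & M+1\leq N,\\[2mm] 1-\dfrac{N+1}{2(M+1)}, & M+1>N.\end{cases}$$ Then: (i) $\delta_{\kappa}^{(+)}(N,M)\geq\widetilde{\beta}(N,M)$; and (ii) $\delta_{\kappa}^{(-)}(N,M)\geq\widetilde{\beta}(N,M)$; where $$\widetilde{\beta}(N,M)\asymp\begin{cases} \dfrac{M}{2N}, & M/N\leq 1,\\[2mm] 1-\dfrac{N}{2M}, & M/N>1,\end{cases}\qquad\text{as } N,M\to\infty .$$
   Context: $\Gamma$ denotes the Euler Gamma function (meromorphically continued, with poles only at the non-positive integers) and $\Gamma^{(n)}$ its $n$-th derivative; "transcendental" means transcendental over $\mathbb{Q}$. For $M\in\mathbb{Z}_{\geq 0}$ put $\mathcal{L}_{\kappa}^{(+)}(M)=\{\kappa,1+\kappa,2+\kappa,\ldots,M+\kappa\}$ and $\mathcal{L}_{\kappa}^{(-)}(M)=\{\kappa,-1+\kappa,-2+\kappa,\ldots,-M+\kappa\}$. The bivariate densities of transcendental values are $$\delta_{\kappa}^{(\pm)}(N,M)=\frac{\#\left\{(n,\widetilde{m})\in\{1,2,\ldots,N\}\times\mathcal{L}_{\kappa}^{(\pm)}(M) : \Gamma^{(n)}(\widetilde{m})\ \text{is transcendental}\right\}}{N(M+1)}$$ (with the same sign chosen throughout). The notation $f(N,M)\asymp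 g(N,M)$ as $N,M\to\infty$ means asymptotic equivalence: $f(N,M)/g(N,M)\to 1$ as $N$ and $M$ both tend to infinity (i.e. as $\min\{N,M\}\to\infty$). *)

theory Defs
  imports "HOL-Complex_Analysis.Complex_Analysis" "HOL-Library.Landau_Symbols"
begin

text \<open>The library predicate \<^const>\<open>algebraic\<close> asks for a nonzero annihilating polynomial with
  integer coefficients, which is the same as being algebraic over the rational numbers.\<close>

definition transcendental :: "complex \<Rightarrow> bool" where
  "transcendental z \<longleftrightarrow> \<not> algebraic z"

definition L_plus :: "real \<Rightarrow> nat \<Rightarrow> real set" where
  "L_plus \<kappa> M = (\<lambda>m. real m + \<kappa>) ` {0..M}"

definition L_minus :: "real \<Rightarrow> nat \<Rightarrow> real set" where
  "L_minus \<kappa> M = (\<lambda>m. - real m + \<kappa>) ` {0..M}"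

definition Gamma_deriv :: "nat \<Rightarrow> real \<Rightarrow> complex" where
  "Gamma_deriv n x = (deriv ^^ n) (Gamma :: complex \<Rightarrow> complex) (complex_of_real x)"

definition delta_plus :: "real \<Rightarrow> nat \<Rightarrow> nat \<Rightarrow> real" where
  "delta_plus \<kappa> N M =
     real (card {(n, x) \<in> {1..N} \<times> L_plus \<kappa> M. transcendental (Gamma_deriv n x)})
       / (real N * (real M + 1))"

definition delta_minus :: "real \<Rightarrow> nat \<Rightarrow> nat \<Rightarrow> real" where
  "delta_minus \<kappa> N M =
     real (card {(n, x) \<in> {1..N} \<times> L_minus \<kappa> M. transcendental (Gamma_deriv n x)})
       / (real N * (real M + 1))"

definition beta_tilde :: "nat \<Rightarrow> nat \<Rightarrow> real" where
  "beta_tilde N M =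
     (if M + 1 \<le> N then real M / (2 * real N)
      else 1 - (real N + 1) / (2 * (real M + 1)))"

end

theory Submission
  imports Defs
begin

text \<open>
  Differentiating \<open>\<Gamma>(z + 1) = z \<Gamma>(z)\<close> repeatedly gives the recurrence
  \<open>\<Gamma>\<^sup>(\<^sup>n\<^sup>)(z + 1) = z \<Gamma>\<^sup>(\<^sup>n\<^sup>)(z) + n \<Gamma>\<^sup>(\<^sup>n\<^sup>-\<^sup>1\<^sup>)(z)\<close>. The heart of the matter is that, for each
  fixed \<open>n\<close>, at most \<open>n\<close> of the values \<open>\<Gamma>\<^sup>(\<^sup>n\<^sup>)(\<kappa> + j)\<close> with \<open>j \<ge> 0\<close> are algebraic, and likewise for
  \<open>\<Gamma>\<^sup>(\<^sup>n\<^sup>)(\<kappa> - j)\<close>. So at least \<open>max 0 (M + 1 - n)\<close> of the \<open>M + 1\<close> values of order \<open>n\<close>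
  are transcendental, and summing this over \<open>n = 1, \<dots>, N\<close> gives the lower bound on the density.

  The values \<open>\<Gamma>\<^sup>(\<^sup>k\<^sup>)(\<kappa> + j)\<close> are transported to the real line, where order arguments are available.
  The algebraic numbers form a subspace of \<open>\<complex>\<close> over \<open>\<rat>\<close>, so, \<open>\<Gamma>(\<kappa>)\<close> being transcendental,
  there is a \<open>\<rat>\<close>-linear \<open>\<phi> : \<complex> \<rightarrow> \<real>\<close> that kills every algebraic number and takes the value \<open>1\<close>
  at \<open>\<Gamma>(\<kappa>)\<close> (lemma \<open>obtain_functional_vanishing_on_algebraic\<close>). Since \<open>\<kappa>\<close> is rational, the
  recurrence has rational coefficients along \<open>\<kappa> + \<int>\<close>, and so the real numbers
  \<open>\<phi>(\<Gamma>\<^sup>(\<^sup>k\<^sup>)(\<kappa> + j))\<close> satisfy it as well. Dividing by the solution \<open>\<kappa> (\<kappa> + 1) \<dots> (\<kappa> + j - 1)\<close> of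
  the homogeneous recurrence yields real sequences \<open>H\<^sub>k\<close> with
  \<open>H\<^sub>k(j + 1) - H\<^sub>k(j) = k / (\<kappa> + j) H\<^sub>k\<^sub>-\<^sub>1(j)\<close> and \<open>H\<^sub>0 = 1\<close>.

  This is a discrete analogue of ``the derivative of \<open>H\<^sub>k\<close> is a positive multiple of \<open>H\<^sub>k\<^sub>-\<^sub>1\<close>'', and
  a discrete version of Rolle's theorem shows, as for polynomials of degree \<open>n\<close>, that \<open>H\<^sub>n\<close> has at
  most \<open>n\<close> zeros (lemma \<open>card_zeros_iterated_difference_le\<close>). Every \<open>j\<close> for which
  \<open>\<Gamma>\<^sup>(\<^sup>n\<^sup>)(\<kappa> + j)\<close> is algebraic is such a zero.
\<close>

section \<open>Algebraic numbers as a rational vector space\<close>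

definition rat_scale :: "rat \<Rightarrow> 'a::field_char_0 \<Rightarrow> 'a"
  where "rat_scale q x = of_rat q * x"

interpretation rat: vector_space "rat_scale :: rat \<Rightarrow> 'a::field_char_0 \<Rightarrow> 'a"
  by unfold_locales (simp_all add: rat_scale_def algebra_simps of_rat_add of_rat_mult)

interpretation rat_pair: vector_space_pair
  "rat_scale :: rat \<Rightarrow> complex \<Rightarrow> complex" "rat_scale :: rat \<Rightarrow> real \<Rightarrow> real"
  by unfold_locales

lemma rat_mult_span:
  fixes x y :: "'a::field_char_0"
  assumes "x \<in> rat.span S" "y \<in> rat.span T"
  shows "x * y \<in> rat.span {s * t | s t. s \<in> S \<and> t \<in> T}"
    (is "_ \<in> rat.span ?U")
proof -
  have base: "s * y \<in> rat.span ?U" if "s \<in> S" for s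
    using assms(2)
  proof (induction rule: rat.span_induct_alt)
    case base
    show ?case by (simp add: rat.span_zero)
  next
    case (step c t y)
    have "s * t \<in> rat.span ?U"
      using step(1) that by (intro rat.span_base) auto
    hence "rat_scale c (s * t) + s * y \<in> rat.span ?U"
      using step(2) by (intro rat.span_add rat.span_scale)
    also have "rat_scale c (s * t) + s * y = s * (rat_scale c t + y)"
      by (simp add: rat_scale_def algebra_simps)
    finally show ?case .
  qed
  show ?thesis
    using assms(1)
  proof (induction rule: rat.span_induct_alt)
    case base
    show ?case by (simp add: rat.span_zero)
  next
    case (step c s x)
    have "rat_scale c (s * y) + x * y \<in> rat.span ?U"
      using base[OF step(1)] step(2) by (intro rat.span_add rat.span_scale)
    also have "rat_scale c (s * y) + x * y = (rat_scale c s + x) * y"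
      by (simp add: rat_scale_def algebra_simps)
    finally show ?case .
  qed
qed

text \<open>
  Together with its converse below, this characterises algebraic numbers by a condition on
  rational spans that passes easily to sums: all powers lie in a finitely generated
  rational space.
\<close>

lemma algebraic_imp_powers_in_finite_span:
  fixes x :: "'a::field_char_0"
  assumes "algebraic x"
  obtains T where "finite T" "\<And>n. x ^ n \<in> rat.span T"
proof -
  obtain p where p: "poly (map_poly of_int p) x = 0" "p \<noteq> 0"
    using assms by (rule algebraicE')
  define d where "d = degree p"
  define T where "T = (\<lambda>i. x ^ i) ` {..<d}"
  define r where "r i = - of_int (coeff p i) / (of_int (coeff p d) :: rat)" for i
  have lc: "coeff p d \<noteq> 0"
    using p(2) by (simp add: d_def)
  have "(\<Sum>i\<le>d. of_int (coeff p i) * x ^ i) = 0"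
    using p(1) by (simp add: poly_altdef d_def coeff_map_poly degree_map_poly)
  hence "(\<Sum>i<d. of_int (coeff p i) * x ^ i) + of_int (coeff p d) * x ^ d = 0"
    by (simp flip: lessThan_Suc_atMost)
  hence "of_int (coeff p d) * x ^ d = - (\<Sum>i<d. of_int (coeff p i) * x ^ i)"
    by (simp add: eq_neg_iff_add_eq_0 add.commute)
  hence "x ^ d = - (\<Sum>i<d. of_int (coeff p i) * x ^ i) / of_int (coeff p d)"
    using lc by (simp add: field_simps)
  also have "\<dots> = (\<Sum>i<d. rat_scale (r i) (x ^ i))"
    by (simp add: rat_scale_def r_def of_rat_divide of_rat_minus sum_divide_distrib
          flip: sum_negf)
  finally have top: "x ^ d = (\<Sum>i<d. rat_scale (r i) (x ^ i))" .
  have "x ^ n \<in> rat.span T" for n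
  proof (induction n rule: less_induct)
    case (less n)
    show ?case
    proof (cases "n < d")
      case True
      thus ?thesis by (auto simp: T_def intro!: rat.span_base)
    next
      case False
      hence "x ^ n = x ^ (n - d) * x ^ d"
        by (simp flip: power_add)
      also have "\<dots> = (\<Sum>i<d. rat_scale (r i) (x ^ (n - d + i)))"
        by (simp add: top sum_distrib_left rat_scale_def power_add algebra_simps)
      also have "\<dots> \<in> rat.span T"
        using False by (intro rat.span_sum rat.span_scale less) auto
      finally show ?thesis .
    qed
  qed
  moreover have "finite T" by (simp add: T_def)
  ultimately show ?thesis using that by blast
qed

text \<open>
  One power more than the size of the spanning set forces either a repetition among the powers
  or a linear dependence between distinct ones; both are polynomial equations.
\<close>

lemma algebraic_if_powers_in_finite_span:
  fixes x :: "'a::field_char_0"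
  assumes T: "finite T" "\<And>n. x ^ n \<in> rat.span T"
  shows "algebraic x"
proof (cases "inj_on (\<lambda>i. x ^ i) {..card T}")
  case False
  then obtain i j where ij: "x ^ i = x ^ j" "i \<noteq> j"
    by (auto simp: inj_on_def)
  define p where "p = monom (1 :: 'a) i - monom 1 j"
  have "coeff p i = 1"
    using ij(2) by (simp add: p_def)
  hence "p \<noteq> 0" by auto
  moreover have "poly p x = 0"
    using ij(1) by (simp add: p_def poly_monom)
  moreover have "coeff p k \<in> \<int>" for k
    by (simp add: p_def)
  ultimately show ?thesis by (intro algebraicI)
next
  case inj: True
  define S where "S = (\<lambda>i. x ^ i) ` {..card T}"
  have "rat.dependent S"
  proof (rule ccontr)
    assume "rat.independent S"
    from rat.independent_span_bound[OF T(1) this] T(2)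
    have "card S \<le> card T" by (auto simp: S_def)
    thus False using inj by (simp add: S_def card_image)
  qed
  then obtain u where u: "(\<Sum>v\<in>S. rat_scale (u v) v) = 0" "\<exists>v\<in>S. u v \<noteq> 0"
    using rat.dependent_finite[of S] by (auto simp: S_def)
  define p where "p = (\<Sum>i\<le>card T. monom (of_rat (u (x ^ i)) :: 'a) i)"
  have coeff: "coeff p k = (if k \<le> card T then of_rat (u (x ^ k)) else 0)" for k
    by (simp add: p_def coeff_sum)
  have "poly p x = (\<Sum>v\<in>S. rat_scale (u v) v)"
    using inj by (simp add: p_def poly_sum poly_monom S_def sum.reindex rat_scale_def)
  hence "poly p x = 0" using u(1) by simp
  moreover have "p \<noteq> 0"
    using u(2) coeff by (auto simp: S_def poly_eq_iff)
  moreover have "coeff p k \<in> \<rat>" for k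
    by (simp add: coeff)
  ultimately show ?thesis by (intro algebraicI')
qed

text \<open>
  By the binomial theorem, products of generators for the powers of \<open>x\<close> and of \<open>y\<close> span all
  powers of \<open>x + y\<close>.
\<close>

lemma algebraic_add:
  fixes x y :: "'a::field_char_0"
  assumes "algebraic x" "algebraic y"
  shows "algebraic (x + y)"
proof -
  obtain S where S: "finite S" "\<And>n. x ^ n \<in> rat.span S"
    using algebraic_imp_powers_in_finite_span[OF assms(1)] by blast
  obtain T where T: "finite T" "\<And>n. y ^ n \<in> rat.span T"
    using algebraic_imp_powers_in_finite_span[OF assms(2)] by blast
  let ?U = "{s * t | s t. s \<in> S \<and> t \<in> T}"
  have "(x + y) ^ n \<in> rat.span ?U" for n
  proof -
    have "(x + y) ^ n =
        (\<Sum>k\<le>n. rat_scale (of_nat (n choose k)) (x ^ k * y ^ (n - k)))"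
      by (simp add: binomial_ring rat_scale_def mult.assoc)
    also have "\<dots> \<in> rat.span ?U"
      using S(2) T(2) by (intro rat.span_sum rat.span_scale rat_mult_span)
    finally show ?thesis .
  qed
  moreover have "finite ?U"
    using finite_image_set2[of "\<lambda>s. s \<in> S" "\<lambda>t. t \<in> T"] S(1) T(1) by simp
  ultimately show ?thesis
    by (intro algebraic_if_powers_in_finite_span)
qed

lemma algebraic_rat_scale:
  fixes x :: "'a::field_char_0"
  assumes "algebraic x"
  shows "algebraic (rat_scale q x)"
proof -
  obtain T where T: "finite T" "\<And>n. x ^ n \<in> rat.span T"
    using algebraic_imp_powers_in_finite_span[OF assms] by blast
  have "rat_scale q x ^ n = rat_scale (q ^ n) (x ^ n)" for n
    by (simp add: rat_scale_def power_mult_distrib of_rat_power)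
  thus ?thesis
    using T by (intro algebraic_if_powers_in_finite_span) (auto intro: rat.span_scale)
qed

text \<open>
  A basis of the algebraic numbers stays independent when \<open>z\<close> is added, so values on it may be
  prescribed freely: \<open>0\<close> on the algebraic part and \<open>1\<close> at \<open>z\<close>. The target is \<open>\<real>\<close> because
  the images will be compared by sign.
\<close>

lemma obtain_functional_vanishing_on_algebraic:
  assumes "transcendental z"
  obtains \<phi> :: "complex \<Rightarrow> real" where
    "\<And>x y. \<phi> (x + y) = \<phi> x + \<phi> y"
    "\<And>r x. r \<in> \<rat> \<Longrightarrow> \<phi> (of_real r * x) = r * \<phi> x"
    "\<And>a. algebraic a \<Longrightarrow> \<phi> a = 0"
    "\<phi> z = 1"
proof -
  define A where "A = {a :: complex. algebraic a}"
  have A: "rat.subspace A"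
    by (auto simp: rat.subspace_def A_def algebraic_add algebraic_rat_scale)
  obtain B where B: "B \<subseteq> A" "rat.independent B" "A \<subseteq> rat.span B"
    using rat.maximal_independent_subset .
  have "z \<notin> rat.span B"
    using rat.span_minimal[OF B(1) A] assms by (auto simp: A_def transcendental_def)
  hence "rat.independent (insert z B)"
    using B(2) by (simp add: rat.independent_insert)
  then obtain \<phi> where \<phi>: "Vector_Spaces.linear rat_scale rat_scale \<phi>"
    and val: "\<And>x. x \<in> insert z B \<Longrightarrow> \<phi> x = (if x = z then 1 else 0 :: real)"
    using rat_pair.linear_independent_extend[of "insert z B" "\<lambda>x. if x = z then 1 else 0"]
    by (metis (no_types, lifting))
  interpret \<phi>: Vector_Spaces.linear rat_scale rat_scale \<phi> by (rule \<phi>)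
  show ?thesis
  proof
    show "\<phi> (x + y) = \<phi> x + \<phi> y" for x y
      by (rule \<phi>.add)
    show "\<phi> (of_real r * x) = r * \<phi> x" if r: "r \<in> \<rat>" for r x
    proof -
      obtain q where q: "r = of_rat q"
        using r by (auto elim: Rats_cases)
      have "of_real (of_rat q) = (of_rat q :: complex)"
        by (cases q) (simp add: of_rat_rat)
      thus ?thesis
        using \<phi>.scale[of q x] by (simp add: rat_scale_def q)
    qed
    show "\<phi> a = 0" if "algebraic a" for a
    proof (rule \<phi>.eq_0_on_span)
      show "a \<in> rat.span B"
        using that B(3) by (auto simp: A_def)
      show "\<phi> b = 0" if "b \<in> B" for b
        using that val[of b] \<open>z \<notin> rat.span B\<close> rat.span_base[of b B] by auto
    qed
    show "\<phi> z = 1" by (simp add: val)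
  qed
qed

section \<open>A discrete Rolle theorem\<close>

text \<open>
  The values of \<open>f\<close> at some \<open>k + 1\<close> increasing positions have the signs of \<open>s, -s, s, \<dots>\<close>, zeros
  counting as either sign. Unlike zeros, which a difference sequence can jump across, this
  property is inherited by differences.
\<close>

definition weakly_alternates :: "real \<Rightarrow> (nat \<Rightarrow> real) \<Rightarrow> nat \<Rightarrow> bool"
  where "weakly_alternates s f k \<longleftrightarrow>
    (\<exists>m. (\<forall>i<k. m i < m (Suc i)) \<and> (\<forall>i\<le>k. s * (-1) ^ i * f (m i) \<ge> 0))"

lemma discrete_descent:
  fixes f :: "nat \<Rightarrow> real"
  assumes "a < b" "f b \<le> f a"
  obtains j where "a \<le> j" "j < b" "f (Suc j) - f j \<le> 0"
proof (rule ccontr)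
  assume "\<not> thesis"
  hence "\<forall>j\<in>{a..<b}. f (Suc j) - f j > 0"
    using that by force
  hence "(\<Sum>j\<in>{a..<b}. f (Suc j) - f j) > 0"
    using assms(1) by (intro sum_pos) auto
  thus False
    using assms by (simp add: sum_Suc_diff')
qed

text \<open>
  Between consecutive positions \<open>f\<close> moves weakly in the direction opposite to the current sign, so
  some single difference in between does too. The half-open intervals are disjoint, which keeps the
  new positions strictly increasing. The offset \<open>r\<close> allows both forward (\<open>r = 0\<close>) and backward
  (\<open>r = 1\<close>) recurrences.
\<close>

lemma discrete_Rolle:
  assumes alt: "weakly_alternates s f (Suc k)"
    and diff: "\<And>j. f (Suc j) - f j = w j * g (j + r)"
    and w: "\<And>j. w j > 0"
  shows "weakly_alternates (- s) g k"
proof -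
  obtain m where m: "\<And>i. i \<le> k \<Longrightarrow> m i < m (Suc i)"
    "\<And>i. i \<le> Suc k \<Longrightarrow> s * (-1) ^ i * f (m i) \<ge> 0"
    using alt unfolding weakly_alternates_def less_Suc_eq_le by blast
  have "\<exists>j. m i \<le> j \<and> j < m (Suc i) \<and> - s * (-1) ^ i * g (j + r) \<ge> 0" if i: "i \<le> k" for i
  proof -
    have "s * (-1) ^ i * f (m (Suc i)) \<le> s * (-1) ^ i * f (m i)"
      using m(2)[of i] m(2)[of "Suc i"] i by simp
    then obtain j where j: "m i \<le> j" "j < m (Suc i)"
      "s * (-1) ^ i * f (Suc j) - s * (-1) ^ i * f j \<le> 0"
      using discrete_descent[OF m(1)[OF i], where f = "\<lambda>j. s * (-1) ^ i * f j"] by blast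
    have "w j * (s * (-1) ^ i * g (j + r)) = s * (-1) ^ i * (f (Suc j) - f j)"
      by (simp add: diff)
    also have "\<dots> \<le> 0" using j(3) by (simp add: algebra_simps)
    finally show ?thesis
      using w[of j] j by (auto simp: mult_le_0_iff)
  qed
  then obtain j where j: "\<And>i. i \<le> k \<Longrightarrow> m i \<le> j i \<and> j i < m (Suc i) \<and>
      - s * (-1) ^ i * g (j i + r) \<ge> 0"
    by metis
  have "j i + r < j (Suc i) + r" if "i < k" for i
    using j[of i] j[of "Suc i"] that by simp
  thus ?thesis
    using j unfolding weakly_alternates_def by (intro exI[of _ "\<lambda>i. j i + r"]) auto
qed

lemma weakly_alternates_zeros:
  assumes "finite Z" "card Z > n" "\<And>j. j \<in> Z \<Longrightarrow> f j = 0"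
  shows "weakly_alternates s f n"
proof -
  define m where "m i = sorted_list_of_set Z ! i" for i
  have "m i < m (Suc i)" if "i < n" for i
    unfolding m_def using assms(2) that
    by (intro sorted_wrt_nth_less[OF strict_sorted_list_of_set]) auto
  moreover have "f (m i) = 0" if "i \<le> n" for i
  proof -
    have "m i \<in> set (sorted_list_of_set Z)"
      unfolding m_def using assms(2) that by (intro nth_mem) auto
    thus ?thesis using assms by simp
  qed
  ultimately show ?thesis
    unfolding weakly_alternates_def by (intro exI[of _ m]) auto
qed

text \<open>
  If \<open>H n\<close> had \<open>n + 1\<close> zeros, it would alternate weakly starting with either sign. Descending to
  level \<open>0\<close>, the constant \<open>c\<close> would be both nonnegative and nonpositive.
\<close>

lemma card_zeros_iterated_difference_le:
  fixes H :: "nat \<Rightarrow> nat \<Rightarrow> real"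
  assumes diff: "\<And>k j. H (Suc k) (Suc j) - H (Suc k) j = w k j * H k (j + r)"
    and w: "\<And>k j. w k j > 0"
    and const: "\<And>j. H 0 j = c" "c \<noteq> 0"
    and Z: "finite Z" "\<And>j. j \<in> Z \<Longrightarrow> H n j = 0"
  shows "card Z \<le> n"
proof (rule ccontr)
  have descent: "weakly_alternates t (H 0) 0" if "\<forall>s. weakly_alternates s (H n) n" for n t
    using that
  proof (induction n)
    case (Suc n)
    have "weakly_alternates s (H n) n" for s
      using discrete_Rolle[OF Suc.prems[rule_format, of "- s"] diff w] by simp
    thus ?case using Suc.IH by blast
  qed simp
  assume "\<not> card Z \<le> n"
  hence "\<forall>s. weakly_alternates s (H n) n"
    using weakly_alternates_zeros[OF Z(1) _ Z(2)] by simp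
  \<comment> \<open>Both starting signs are available, so one may choose the sign that contradicts that of \<open>c\<close>.\<close>
  hence "weakly_alternates (- c) (H 0) 0"
    by (rule descent)
  hence "c * c \<le> 0"
    by (simp add: weakly_alternates_def const(1))
  thus False using const(2) by (auto simp: mult_le_0_iff order_antisym)
qed


section \<open>Algebraic values of derivatives of the Gamma function\<close>

text \<open>
  In the Leibniz rule for \<open>w \<Gamma>(w)\<close> only the terms with at most one derivative on the
  factor \<open>w\<close> survive. For \<open>n = 0\<close> the truncated index \<open>n - 1\<close> is harmless, as its
  coefficient vanishes.
\<close>

lemma higher_deriv_Gamma_plus1:
  fixes z :: complex
  assumes "z \<notin> \<int>\<^sub>\<le>\<^sub>0"
  shows "(deriv ^^ n) Gamma (z + 1) =
    z * (deriv ^^ n) Gamma z + of_nat n * (deriv ^^ (n - 1)) Gamma z"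
proof -
  define S where "S = - (\<int>\<^sub>\<le>\<^sub>0 :: complex set)"
  have S: "open S" "z \<in> S"
    using assms by (auto simp: S_def open_Compl)
  have shift: "1 * w + 1 \<in> S" if "w \<in> S" for w
    using that by (auto simp: S_def dest: plus_one_in_nonpos_Ints_imp)
  have holo: "Gamma holomorphic_on S"
    by (intro holomorphic_Gamma) (auto simp: S_def)
  have holo_shift: "(\<lambda>w. Gamma (1 * w + 1)) holomorphic_on S"
    by (intro holomorphic_Gamma' holomorphic_intros)
       (use shift in \<open>auto simp: S_def\<close>)
  have "(deriv ^^ n) Gamma (z + 1) = (deriv ^^ n) (\<lambda>w. Gamma (1 * w + 1)) z"
    using higher_deriv_compose_linear'[OF holo S(1) S(1) S(2) shift, of n] by simp
  also have "\<dots> = (deriv ^^ n) (\<lambda>w. w * Gamma w) z"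
    by (rule higher_deriv_transform_within_open[OF holo_shift _ S])
       (auto intro!: holomorphic_intros holo simp: S_def Gamma_plus1)
  also have "\<dots> = (\<Sum>i = 0..n. of_nat (n choose i) *
      (deriv ^^ i) (\<lambda>w. w) z * (deriv ^^ (n - i)) Gamma z)"
    by (rule higher_deriv_mult[OF _ holo S]) (intro holomorphic_intros)
  also have "\<dots> = (\<Sum>i\<in>{0..n} \<inter> {0, 1}. of_nat (n choose i) *
      (deriv ^^ i) (\<lambda>w. w) z * (deriv ^^ (n - i)) Gamma z)"
    by (intro sum.mono_neutral_right) auto
  also have "\<dots> = z * (deriv ^^ n) Gamma z + of_nat n * (deriv ^^ (n - 1)) Gamma z"
    by (cases n) (auto simp: Int_insert_right)
  finally show ?thesis .
qed

lemma Gamma_deriv_plus1: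
  assumes "x \<notin> \<int>"
  shows "Gamma_deriv n (x + 1) =
    of_real x * Gamma_deriv n x + of_nat n * Gamma_deriv (n - 1) x"
proof -
  have "complex_of_real x \<notin> \<int>\<^sub>\<le>\<^sub>0"
    using assms nonpos_Ints_Int by (auto simp: of_real_in_nonpos_Ints_iff)
  thus ?thesis
    using higher_deriv_Gamma_plus1 by (simp add: Gamma_deriv_def)
qed

lemma not_Ints_of_between_0_1:
  fixes \<kappa> :: real
  assumes "0 < \<kappa>" "\<kappa> < 1"
  shows "\<kappa> \<notin> \<int>"
  using assms by (auto elim!: Ints_cases)

text \<open>
  Positivity of the coefficients \<open>k / (j + \<kappa>)\<close> is what makes the Rolle argument applicable; the
  Pochhammer symbol solves the homogeneous part of the recurrence.
\<close>

lemma card_algebraic_Gamma_deriv_right_le: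
  assumes \<kappa>: "0 < \<kappa>" "\<kappa> < 1" "\<kappa> \<in> \<rat>"
    and tr: "transcendental (Gamma (complex_of_real \<kappa>))"
    and Z: "finite Z" "\<And>j. j \<in> Z \<Longrightarrow> algebraic (Gamma_deriv n (real j + \<kappa>))"
  shows "card Z \<le> n"
proof -
  obtain \<phi> :: "complex \<Rightarrow> real" where \<phi>:
    "\<And>x y. \<phi> (x + y) = \<phi> x + \<phi> y"
    "\<And>r x. r \<in> \<rat> \<Longrightarrow> \<phi> (of_real r * x) = r * \<phi> x"
    "\<And>a. algebraic a \<Longrightarrow> \<phi> a = 0" "\<phi> (Gamma (of_real \<kappa>)) = 1"
    using obtain_functional_vanishing_on_algebraic[OF tr] by blast
  define G where "G k j = \<phi> (Gamma_deriv k (real j + \<kappa>))" for k j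
  have G_Suc: "G k (Suc j) = (real j + \<kappa>) * G k j + real k * G (k - 1) j" for k j
  proof -
    have "real j + \<kappa> \<notin> \<int>"
      using not_Ints_of_between_0_1[OF \<kappa>(1,2)] Ints_diff[of "real j + \<kappa>" "real j"] by auto
    from Gamma_deriv_plus1[OF this, of k] show ?thesis
      using \<phi>(2)[of "real j + \<kappa>"] \<phi>(2)[of "real k"] \<kappa>(3)
      by (simp add: G_def \<phi>(1) add_ac)
  qed
  define H where "H k j = G k j / pochhammer \<kappa> j" for k j
  have H_Suc: "H k (Suc j) = H k j + real k / (real j + \<kappa>) * H (k - 1) j" for k j
  proof -
    have "real j + \<kappa> \<noteq> 0"
      using \<kappa>(1) by simp
    thus ?thesis
      by (simp add: H_def G_Suc pochhammer_Suc add_divide_distrib add.commute[of \<kappa>] mult.commute)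
  qed
  have H_0: "H 0 j = 1" for j
    by (induction j) (simp_all add: H_Suc, simp add: H_def G_def Gamma_deriv_def \<phi>(4))
  show ?thesis
  proof (rule card_zeros_iterated_difference_le[where H = H and c = 1 and r = 0])
    show "H (Suc k) (Suc j) - H (Suc k) j = real (Suc k) / (real j + \<kappa>) * H k (j + 0)" for k j
      by (simp add: H_Suc)
    show "real (Suc k) / (real j + \<kappa>) > 0" for k j
      using \<kappa>(1) by simp
    show "H n j = 0" if "j \<in> Z" for j
      using Z(2)[OF that] by (simp add: H_def G_def \<phi>(3))
  qed (simp_all add: H_0 Z(1))
qed

text \<open>
  Moving left, the recurrence is read backwards: the value at \<open>j + 1\<close> of order \<open>k - 1\<close> governs the
  step from \<open>j\<close> to \<open>j + 1\<close>, hence the offset \<open>1\<close>. All base points \<open>\<kappa> - (j + 1)\<close> are negative, and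
  the minus sign from solving for the step turns them into the positive \<open>j + 1 - \<kappa>\<close>.
\<close>

lemma card_algebraic_Gamma_deriv_left_le:
  assumes \<kappa>: "0 < \<kappa>" "\<kappa> < 1" "\<kappa> \<in> \<rat>"
    and tr: "transcendental (Gamma (complex_of_real \<kappa>))"
    and Z: "finite Z" "\<And>j. j \<in> Z \<Longrightarrow> algebraic (Gamma_deriv n (- real j + \<kappa>))"
  shows "card Z \<le> n"
proof -
  obtain \<phi> :: "complex \<Rightarrow> real" where \<phi>:
    "\<And>x y. \<phi> (x + y) = \<phi> x + \<phi> y"
    "\<And>r x. r \<in> \<rat> \<Longrightarrow> \<phi> (of_real r * x) = r * \<phi> x"
    "\<And>a. algebraic a \<Longrightarrow> \<phi> a = 0" "\<phi> (Gamma (of_real \<kappa>)) = 1"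
    using obtain_functional_vanishing_on_algebraic[OF tr] by blast
  define G where "G k j = \<phi> (Gamma_deriv k (- real j + \<kappa>))" for k j
  have G_Suc: "G k j = (\<kappa> - real (Suc j)) * G k (Suc j) + real k * G (k - 1) (Suc j)" for k j
  proof -
    have nonint: "\<kappa> - real (Suc j) \<notin> \<int>"
      using not_Ints_of_between_0_1[OF \<kappa>(1,2)] Ints_add[of "\<kappa> - real (Suc j)" "real (Suc j)"]
      by auto
    have "- real j + \<kappa> = \<kappa> - real (Suc j) + 1" "- real (Suc j) + \<kappa> = \<kappa> - real (Suc j)"
      by simp_all
    hence "Gamma_deriv k (- real j + \<kappa>) =
        of_real (\<kappa> - real (Suc j)) * Gamma_deriv k (- real (Suc j) + \<kappa>) +
        of_real (real k) * Gamma_deriv (k - 1) (- real (Suc j) + \<kappa>)"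
      by (simp only: Gamma_deriv_plus1[OF nonint] of_real_of_nat_eq)
    thus ?thesis
      using \<kappa>(3) by (simp only: G_def \<phi>(1) \<phi>(2) Rats_diff Rats_of_nat)
  qed
  define Q where "Q j = (\<Prod>i<j. \<kappa> - real (Suc i))" for j
  define H where "H k j = Q j * G k j" for k j
  have neg: "\<kappa> - real (Suc j) < 0" for j
    using \<kappa>(2) by simp
  have H_Suc: "H k (Suc j) = H k j + real k / (real (Suc j) - \<kappa>) * H (k - 1) (Suc j)" for k j
  proof -
    have "H k j = H k (Suc j) + real k * Q j * G (k - 1) (Suc j)"
      by (simp add: H_def Q_def G_Suc[of k j] algebra_simps)
    moreover have "Q j = - (Q (Suc j) / (real (Suc j) - \<kappa>))"
      using neg[of j] by (simp add: Q_def field_simps)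
    ultimately show ?thesis by (simp add: H_def)
  qed
  have H_0: "H 0 j = 1" for j
  proof (induction j)
    case 0
    show ?case by (simp add: H_def Q_def G_def Gamma_deriv_def \<phi>(4))
  next
    case (Suc j)
    thus ?case using H_Suc[of 0 j] by simp
  qed
  show ?thesis
  proof (rule card_zeros_iterated_difference_le[where H = H and c = 1 and r = 1])
    show "H (Suc k) (Suc j) - H (Suc k) j =
        real (Suc k) / (real (Suc j) - \<kappa>) * H k (j + 1)" for k j
      using H_Suc[of "Suc k" j] by simp
    show "real (Suc k) / (real (Suc j) - \<kappa>) > 0" for k j
      using neg[of j] by simp
    show "H n j = 0" if "j \<in> Z" for j
      using Z(2)[OF that] by (simp add: H_def G_def \<phi>(3))
  qed (simp_all add: H_0 Z(1))
qed

section \<open>Counting and asymptotics\<close>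

text \<open>
  The two cases in the definition of \<^const>\<open>beta_tilde\<close> reflect whether the truncated subtraction \<open>M + 1 - n\<close> reaches \<open>0\<close> within
  the range of summation.
\<close>

lemma sum_truncated_eq_beta_tilde:
  assumes "N \<ge> 1"
  shows "(\<Sum>n=1..N. real (M + 1 - n)) = beta_tilde N M * (real N * (real M + 1))"
proof -
  have gauss: "(\<Sum>n=1..K. real (M + 1 - n)) = real K * (real M + 1) - real K * (real K + 1) / 2"
    if "K \<le> M + 1" for K
    using that by (induction K) (auto simp: of_nat_diff field_simps)
  show ?thesis
  proof (cases "M + 1 \<le> N")
    case True
    have "(\<Sum>n=1..N. real (M + 1 - n)) = (\<Sum>n=1..M + 1. real (M + 1 - n))"
      using True by (intro sum.mono_neutral_right) auto
    also have "\<dots> = real M * (real M + 1) / 2"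
      by (subst gauss) (auto simp: field_simps)
    also have "\<dots> = beta_tilde N M * (real N * (real M + 1))"
      using True assms by (simp add: beta_tilde_def)
    finally show ?thesis .
  next
    case False
    thus ?thesis
      by (subst gauss) (auto simp: beta_tilde_def field_simps)
  qed
qed

lemma density_ge_beta_tilde:
  fixes p :: "nat \<Rightarrow> real"
  assumes "inj p" "N \<ge> 1"
    and alg: "\<And>n. card {m \<in> {0..M}. \<not> P n (p m)} \<le> n"
  shows "real (card {(n, x) \<in> {1..N} \<times> p ` {0..M}. P n x}) / (real N * (real M + 1))
    \<ge> beta_tilde N M"
proof -
  have "M + 1 - n \<le> card {x \<in> p ` {0..M}. P n x}" for n
  proof -
    have "M + 1 = card ({m \<in> {0..M}. P n (p m)} \<union> {m \<in> {0..M}. \<not> P n (p m)})"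
    proof -
      have "{m \<in> {0..M}. P n (p m)} \<union> {m \<in> {0..M}. \<not> P n (p m)} = {0..M}"
        by auto
      thus ?thesis by (simp only: card_atLeastAtMost)
    qed
    also have "\<dots> \<le> card {m \<in> {0..M}. P n (p m)} + n"
      using card_Un_le[of "{m \<in> {0..M}. P n (p m)}" "{m \<in> {0..M}. \<not> P n (p m)}"] alg[of n]
      by simp
    also have "card {m \<in> {0..M}. P n (p m)} = card (p ` {m \<in> {0..M}. P n (p m)})"
      using assms(1) by (intro card_image[symmetric] inj_on_subset[OF assms(1)]) auto
    also have "p ` {m \<in> {0..M}. P n (p m)} = {x \<in> p ` {0..M}. P n x}"
      by auto
    finally show ?thesis by simp
  qed
  hence "(\<Sum>n=1..N. real (M + 1 - n)) \<le> (\<Sum>n=1..N. real (card {x \<in> p ` {0..M}. P n x}))"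
    by (intro sum_mono of_nat_mono)
  also have "\<dots> = real (card (SIGMA n:{1..N}. {x \<in> p ` {0..M}. P n x}))"
    by simp
  also have "(SIGMA n:{1..N}. {x \<in> p ` {0..M}. P n x}) = {(n, x) \<in> {1..N} \<times> p ` {0..M}. P n x}"
    by auto
  finally show ?thesis
    using assms(2) sum_truncated_eq_beta_tilde[OF assms(2), of M]
    by (simp add: pos_le_divide_eq)
qed

text \<open>
  For \<open>M \<le> N\<close> the two sides agree exactly. For \<open>M > N\<close> they differ by at most
  \<open>1 / (2 M)\<close>, while the right-hand side is at least \<open>1 / 2\<close>; hence the quotient is within
  \<open>1 / M\<close> of \<open>1\<close>, uniformly in \<open>N\<close>.
\<close>

lemma beta_tilde_asymp_equiv:
  "(\<lambda>(N, M). beta_tilde N M) \<sim>[sequentially \<times>\<^sub>F sequentially]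
      (\<lambda>(N, M). if real M / real N \<le> 1 then real M / (2 * real N)
                else 1 - real N / (2 * real M))"
proof -
  define g where "g N M = (if real M / real N \<le> 1 then real M / (2 * real N)
      else 1 - real N / (2 * real M))" for N M :: nat
  have bound: "\<bar>beta_tilde N M / g N M - 1\<bar> \<le> 1 / real M" if "N \<ge> 1" "M \<ge> 1" for N M
  proof (cases "M \<le> N")
    case True
    hence "beta_tilde N M = g N M"
      using that by (cases "M = N") (auto simp: beta_tilde_def g_def field_simps)
    moreover have "g N M > 0"
      using True that by (auto simp: g_def)
    ultimately show ?thesis by simp
  next
    case False
    have g: "g N M = 1 - real N / (2 * real M)" "g N M \<ge> 1 / 2"
      using False that by (auto simp: g_def field_simps)
    have "beta_tilde N M - g N M = - ((real M - real N) / (2 * real M * (real M + 1)))"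
      using False that by (simp add: beta_tilde_def g(1) divide_simps) (simp add: algebra_simps)
    hence "\<bar>beta_tilde N M - g N M\<bar> = (real M - real N) / (2 * real M * (real M + 1))"
      using False by simp
    also have "\<dots> \<le> (real M + 1) / (2 * real M * (real M + 1))"
      by (intro divide_right_mono) auto
    also have "\<dots> = 1 / real M * (1 / 2)"
      by simp
    also have "\<dots> \<le> 1 / real M * g N M"
      using g(2) by (intro mult_left_mono) auto
    finally have "\<bar>beta_tilde N M - g N M\<bar> / g N M \<le> 1 / real M"
      using g(2) by (simp add: pos_divide_le_eq)
    moreover have "beta_tilde N M / g N M - 1 = (beta_tilde N M - g N M) / g N M"
      using g(2) by (simp add: diff_divide_distrib)
    hence "\<bar>beta_tilde N M / g N M - 1\<bar> = \<bar>beta_tilde N M - g N M\<bar> / g N M"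
      using g(2) by (simp add: abs_divide)
    ultimately show ?thesis by simp
  qed
  have lim: "((\<lambda>x. 1 / real (snd x)) \<longlongrightarrow> 0) (sequentially \<times>\<^sub>F sequentially)"
    by (rule filterlim_compose[OF lim_1_over_n filterlim_snd])
  have "((\<lambda>x. (case x of (N, M) \<Rightarrow> beta_tilde N M) / (case x of (N, M) \<Rightarrow> g N M) - 1) \<longlongrightarrow> 0)
      (sequentially \<times>\<^sub>F sequentially)"
  proof (rule Lim_null_comparison[OF _ lim])
    show "\<forall>\<^sub>F x in sequentially \<times>\<^sub>F sequentially.
      norm ((case x of (N, M) \<Rightarrow> beta_tilde N M) / (case x of (N, M) \<Rightarrow> g N M) - 1)
        \<le> 1 / real (snd x)"
      unfolding eventually_prod_sequentially using bound by (intro exI[of _ 1]) auto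
  qed
  hence "(\<lambda>(N, M). beta_tilde N M) \<sim>[sequentially \<times>\<^sub>F sequentially] (\<lambda>(N, M). g N M)"
    by (intro asymp_equivI') (simp add: LIM_zero_iff)
  thus ?thesis by (simp add: g_def)
qed

theorem theorem4:
  fixes \<kappa> :: real
  assumes "\<kappa> \<in> {0<..<1}" and "\<kappa> \<in> \<rat>"
    and "transcendental (Gamma (complex_of_real \<kappa>))"
  shows "(\<forall>N M :: nat. N \<ge> 1 \<longrightarrow> delta_plus \<kappa> N M \<ge> beta_tilde N M) \<and>
    (\<forall>N M :: nat. N \<ge> 1 \<longrightarrow> delta_minus \<kappa> N M \<ge> beta_tilde N M) \<and>
    (\<lambda>(N, M). beta_tilde N M) \<sim>[sequentially \<times>\<^sub>F sequentially]
      (\<lambda>(N, M). if real M / real N \<le> 1 then real M / (2 * real N)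
                else 1 - real N / (2 * real M))"
proof (intro conjI allI impI)
  have \<kappa>: "0 < \<kappa>" "\<kappa> < 1" using assms(1) by auto
  fix N M :: nat
  assume N: "N \<ge> 1"
  show "delta_plus \<kappa> N M \<ge> beta_tilde N M"
    unfolding delta_plus_def L_plus_def
  proof (rule density_ge_beta_tilde[OF _ N])
    show "card {m \<in> {0..M}. \<not> transcendental (Gamma_deriv n (real m + \<kappa>))} \<le> n" for n
      by (rule card_algebraic_Gamma_deriv_right_le[OF \<kappa> assms(2,3)])
         (auto simp: transcendental_def)
  qed (auto intro: injI)
  show "delta_minus \<kappa> N M \<ge> beta_tilde N M"
    unfolding delta_minus_def L_minus_def
  proof (rule density_ge_beta_tilde[OF _ N])
    show "card {m \<in> {0..M}. \<not> transcendental (Gamma_deriv n (- real m + \<kappa>))} \<le> n" for n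
      by (rule card_algebraic_Gamma_deriv_left_le[OF \<kappa> assms(2,3)])
         (auto simp: transcendental_def)
  qed (auto intro: injI)
qed (rule beta_tilde_asymp_equiv)

end
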